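(* Let $\mathcal{H}$ be a complex Hilbert space, $T_2,T_3\in\mathcal{L}(\mathcal{H})$ and $q\in(0,1]$. Then for every integer $n\ge1$, $$w_q\left(\begin{bmatrix} O & T_2 \\ {} T_3 & O \end{bmatrix}\right)\ge q^{2n-1}\left[\max\{w_q((T_2T_3)^n),\,w_q((T_3T_2)^n)\}\right]^{\frac{1}{2n}}.$$
   Context: $\mathcal{L}(\mathcal{H})$ is the algebra of bounded linear operators on the complex Hilbert space $\mathcal{H}$. For $q\in\mathbb{C}$ with $|q|\le 1$, the $q$-numerical radius of a bounded operator $T$ on a Hilbert space $\mathcal{K}$ is $w_q(T)=\sup\{|\langle Tx,y\rangle| : x,y\in\mathcal{K},\ \|x\|=\|y\|=1,\ \langle x,y\rangle=q\}$. When $|q|<1$ it is understood that $\dim\mathcal{H}\ge 2$, so that this supremum is over a nonempty set. A $2\times2$ operator matrix with entries in $\mathcal{L}(\mathcal{H})$ acts on the Hilbert space direct sum $\mathcal{H}\oplus\mathcal{H}$; $O$ is the zero operator. *)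

theory Defs
  imports "HOL-Analysis.Analysis"
begin

text \<open>
  Complex inner product spaces, on top of the real ones of the library: \<^term>\<open>inner\<close> is the real
  part of the complex inner product, so \<^term>\<open>norm x\<close> is the square root of
  \<open>\<langle>x, x\<rangle>\<close>, and positive definiteness is inherited from \<^class>\<open>real_inner\<close>.
  The complex inner product is linear in its first argument.
\<close>

class complex_inner = real_inner +
  fixes scaleC :: "complex \<Rightarrow> 'a \<Rightarrow> 'a" (infixr "*\<^sub>C" 75)
    and cinner :: "'a \<Rightarrow> 'a \<Rightarrow> complex"
  assumes scaleC_add_right: "c *\<^sub>C (x + y) = c *\<^sub>C x + c *\<^sub>C y"
    and scaleC_add_left: "(c + d) *\<^sub>C x = c *\<^sub>C x + d *\<^sub>C x"
    and scaleC_scaleC: "c *\<^sub>C d *\<^sub>C x = (c * d) *\<^sub>C x"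
    and scaleC_of_real: "complex_of_real r *\<^sub>C x = r *\<^sub>R x"
    and cinner_commute: "cinner x y = cnj (cinner y x)"
    and cinner_add_left: "cinner (x + y) z = cinner x z + cinner y z"
    and cinner_scaleC_left: "cinner (c *\<^sub>C x) y = c * cinner x y"
    and inner_eq_Re_cinner: "inner x y = Re (cinner x y)"

class complex_hilbert = complex_inner + complete_space

interpretation complex_vector: vector_space "scaleC :: complex \<Rightarrow> 'a \<Rightarrow> 'a::complex_inner"
proof
  show "1 *\<^sub>C x = x" for x :: 'a
    using scaleC_of_real[of 1 x] by simp
qed (simp_all add: scaleC_add_right scaleC_add_left scaleC_scaleC)

text \<open>The Hilbert space direct sum is the product type.\<close>

instantiation prod :: (complex_inner, complex_inner) complex_inner
begin

definition scaleC_prod_def: "c *\<^sub>C p = (c *\<^sub>C fst p, c *\<^sub>C snd p)"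

definition cinner_prod_def: "cinner p p' = cinner (fst p) (fst p') + cinner (snd p) (snd p')"

instance
proof
  show "cinner x y = cnj (cinner y x)" for x y :: "'a \<times> 'b"
    unfolding cinner_prod_def
    using cinner_commute[of "fst x" "fst y"] cinner_commute[of "snd x" "snd y"] by simp
qed (simp_all add: scaleC_prod_def cinner_prod_def scaleC_add_right scaleC_add_left scaleC_scaleC
    scaleC_of_real cinner_add_left cinner_scaleC_left inner_eq_Re_cinner inner_prod_def
    scaleR_prod_def algebra_simps)

end

instance prod :: (complex_hilbert, complex_hilbert) complex_hilbert ..

definition bounded_clinear :: "('a::complex_inner \<Rightarrow> 'b::complex_inner) \<Rightarrow> bool" where
  "bounded_clinear T \<longleftrightarrow> bounded_linear T \<and> (\<forall>c x. T (c *\<^sub>C x) = c *\<^sub>C T x)"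

definition op_matrix ::
    "('a \<Rightarrow> 'a) \<Rightarrow> ('a \<Rightarrow> 'a) \<Rightarrow> ('a \<Rightarrow> 'a) \<Rightarrow> ('a \<Rightarrow> 'a) \<Rightarrow> 'a \<times> 'a \<Rightarrow> 'a \<times> 'a::complex_inner" where
  "op_matrix A B C D = (\<lambda>(x, y). (A x + B y, C x + D y))"

text \<open>
  The supremum is taken in \<open>[0, \<infinity>)\<close>, where the supremum of the empty set is \<open>0\<close>; the library
  leaves \<^term>\<open>Sup ({} :: real set)\<close> unspecified. The empty set occurs only if the
  space is zero, or one-dimensional and \<open>\<bar>q\<bar> < 1\<close>.
\<close>

definition q_numerical_radius :: "complex \<Rightarrow> ('a::complex_inner \<Rightarrow> 'a) \<Rightarrow> real" where
  "q_numerical_radius q T =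
    (let S = {cmod (cinner (T x) y) | x y. norm x = 1 \<and> norm y = 1 \<and> cinner x y = q}
     in if S = {} then 0 else Sup S)"

end

theory Submission imports Defs begin

text \<open>
  Put \<open>M\<close> for the off-diagonal operator matrix, so that \<open>M\<^sup>2\<^sup>n\<close> is the diagonal matrix with entries
  \<open>(T\<^sub>2T\<^sub>3)\<^sup>n\<close> and \<open>(T\<^sub>3T\<^sub>2)\<^sup>n\<close>. It suffices to prove the power inequality
  \<open>w\<^sub>q(T\<^sup>m) \<le> q (w\<^sub>q(T) / q)\<^sup>m\<close>, which extends Pearcy's proof of the case \<open>q = 1\<close>.
  Let \<open>x \<and> u\<close> be the area of the parallelogram spanned by \<open>x\<close> and \<open>u\<close>. Optimising over
  \<open>y = q x + \<surd>(1 - q\<^sup>2) z\<close> with \<open>z\<close> orthogonal to \<open>x\<close>, the bound \<open>w\<^sub>q(T) \<le> q\<close> says that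
  \<open>q \<bar>\<langle>Tx, x\<rangle>\<bar> + \<surd>(1 - q\<^sup>2) (x \<and> Tx) \<le> q \<parallel>x\<parallel>\<^sup>2\<close> for all \<open>x\<close>.
  With the \<open>m\<close>-th roots of unity \<open>\<omega>\<^sub>j\<close>, the vectors \<open>x\<^sub>j = (\<Sum>k<m. \<omega>\<^sub>j\<^sup>k T\<^sup>k x) / m\<close> add up to \<open>x\<close>, and
  \<open>u = x\<^sub>j - \<omega>\<^sub>j T x\<^sub>j = (x - T\<^sup>m x) / m\<close> does not depend on \<open>j\<close>. The bound at \<open>x\<^sub>j\<close> reads
  \<open>q Re \<langle>u, x\<^sub>j\<rangle> \<ge> \<surd>(1 - q\<^sup>2) (x\<^sub>j \<and> u)\<close>; since \<open>x \<and> u\<close> is a seminorm in \<open>x\<close>,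
  summation over \<open>j\<close> gives the corresponding bound for \<open>T\<^sup>m\<close> at \<open>x\<close>.
\<close>

section \<open>Complex inner products\<close>

lemma cinner_zero_left [simp]: "cinner 0 (y::'a::complex_inner) = 0"
  using cinner_add_left[of 0 0 y] by simp

lemma cinner_zero_right [simp]: "cinner (x::'a::complex_inner) 0 = 0"
  using cinner_commute[of x 0] by simp

lemma cinner_add_right: "cinner (x::'a::complex_inner) (y + z) = cinner x y + cinner x z"
  by (metis cinner_add_left cinner_commute complex_cnj_add)

lemma cinner_scaleC_right: "cinner (x::'a::complex_inner) (c *\<^sub>C y) = cnj c * cinner x y"
  by (metis cinner_scaleC_left cinner_commute complex_cnj_mult)

lemma cinner_minus_left: "cinner (- x) (y::'a::complex_inner) = - cinner x y"
  using cinner_add_left[of "-x" x y] by (simp add: eq_neg_iff_add_eq_0)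

lemma cinner_diff_left: "cinner (x - y) (z::'a::complex_inner) = cinner x z - cinner y z"
  using cinner_add_left[of x "-y" z] by (simp add: cinner_minus_left)

lemma cinner_sum_right: "cinner (x::'a::complex_inner) (sum f A) = (\<Sum>i\<in>A. cinner x (f i))"
  by (induction A rule: infinite_finite_induct) (auto simp: cinner_add_right)

lemma cinner_self: "cinner x (x::'a::complex_inner) = complex_of_real ((norm x)\<^sup>2)"
proof (rule complex_eqI)
  show "Re (cinner x x) = Re (complex_of_real ((norm x)\<^sup>2))"
    by (simp add: inner_eq_Re_cinner[symmetric] dot_square_norm)
  have "Im (cinner x x) = - Im (cinner x x)"
    using arg_cong[OF cinner_commute[of x x], of Im] by simp
  then show "Im (cinner x x) = Im (complex_of_real ((norm x)\<^sup>2))" by simp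
qed

lemma norm_scaleC [simp]: "norm (c *\<^sub>C (x::'a::complex_inner)) = cmod c * norm x"
proof -
  have "complex_of_real ((norm (c *\<^sub>C x))\<^sup>2) = complex_of_real ((cmod c * norm x)\<^sup>2)"
    unfolding cinner_self[symmetric] cinner_scaleC_left cinner_scaleC_right
    using complex_norm_square[of c]
    by (simp add: cinner_self power_mult_distrib mult.commute)
  then show ?thesis
    unfolding of_real_eq_iff by (simp add: power2_eq_iff_nonneg)
qed

lemma obtain_phase:
  obtains \<zeta> where "cmod \<zeta> = 1" "\<zeta> * d = complex_of_real (cmod d)"
proof (cases "d = 0")
  case True
  then show ?thesis using that[of 1] by simp
next
  case False
  then show ?thesis
    using that[of "cnj d / cmod d"] complex_norm_square[of d]
    by (simp add: norm_divide power2_eq_square mult.commute[of "cnj d" d] divide_eq_eq)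
qed

lemma complex_Cauchy_Schwarz: "cmod (cinner x (y::'a::complex_inner)) \<le> norm x * norm y"
proof -
  obtain \<zeta> where \<zeta>: "cmod \<zeta> = 1" "\<zeta> * cinner x y = cmod (cinner x y)"
    by (rule obtain_phase)
  have "cmod (cinner x y) = inner (\<zeta> *\<^sub>C x) y"
    unfolding inner_eq_Re_cinner cinner_scaleC_left \<zeta> by simp
  also have "\<dots> \<le> norm (\<zeta> *\<^sub>C x) * norm y" by (rule norm_cauchy_schwarz)
  finally show ?thesis by (simp add: \<zeta>)
qed

lemma cmod_cinner_commute: "cmod (cinner x (y::'a::complex_inner)) = cmod (cinner y x)"
  by (metis cinner_commute complex_mod_cnj)

section \<open>The area of a parallelogram\<close>

text \<open>The square root of the Gram determinant of \<open>x\<close> and \<open>u\<close>. For a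
  unit vector \<open>x\<close> it is the distance from \<open>u\<close> to the complex line through
  \<open>x\<close>.\<close>

definition area :: "'a::complex_inner \<Rightarrow> 'a \<Rightarrow> real" where
  "area x u = sqrt ((norm x)\<^sup>2 * (norm u)\<^sup>2 - (cmod (cinner x u))\<^sup>2)"

lemma area_commute: "area x u = area u x"
  by (simp add: area_def cmod_cinner_commute mult.commute)

lemma area_nonneg: "area x u \<ge> 0"
  using complex_Cauchy_Schwarz[of x u]
  by (auto simp: area_def power_mult_distrib[symmetric] intro!: power_mono)

lemma area_zero_left [simp]: "area 0 u = 0"
  by (simp add: area_def)

text \<open>The vector on the right is \<open>(norm u)\<^sup>2\<close> times the component of
  \<open>x\<close> orthogonal to \<open>u\<close>. It depends linearly on \<open>x\<close>, which is
  what makes the area a seminorm in \<open>x\<close>; scaling by \<open>norm u\<close> avoids a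
  division when \<open>u = 0\<close>.\<close>

lemma norm_mult_area:
  "norm u * area x u = norm (complex_of_real ((norm u)\<^sup>2) *\<^sub>C x - cinner x u *\<^sub>C u)"
  (is "_ = norm ?w")
proof -
  let ?N = "complex_of_real ((norm u)\<^sup>2)" and ?d = "cinner x u"
  have wu: "cinner ?w u = 0"
    by (simp add: cinner_diff_left cinner_scaleC_left cinner_self)
  have "cinner ?w ?w = cinner ?w (?N *\<^sub>C x) - cnj ?d * cinner ?w u"
    by (metis cinner_commute cinner_diff_left cinner_scaleC_right complex_cnj_diff)
  also have "\<dots> = ?N * (?N * complex_of_real ((norm x)\<^sup>2) - ?d * cnj ?d)"
    using wu cinner_commute[of u x]
    by (simp add: cinner_scaleC_right cinner_diff_left cinner_scaleC_left cinner_self)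
  also have "\<dots> = complex_of_real ((norm u)\<^sup>2 * ((norm x)\<^sup>2 * (norm u)\<^sup>2 - (cmod ?d)\<^sup>2))"
    by (simp add: complex_norm_square[symmetric] mult.commute del: of_real_power)
  finally have "(norm ?w)\<^sup>2 = (norm u)\<^sup>2 * ((norm x)\<^sup>2 * (norm u)\<^sup>2 - (cmod ?d)\<^sup>2)"
    unfolding cinner_self of_real_eq_iff .
  then have "norm ?w = sqrt ((norm u)\<^sup>2 * ((norm x)\<^sup>2 * (norm u)\<^sup>2 - (cmod ?d)\<^sup>2))"
    by (metis norm_ge_zero real_sqrt_abs abs_of_nonneg)
  then show ?thesis
    by (simp add: area_def real_sqrt_mult)
qed

lemma area_add_left: "area (x + y) u \<le> area x u + area y u"
proof (cases "u = 0")
  case True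
  then show ?thesis by (simp add: area_commute[of _ 0])
next
  case False
  have "norm u * area (x + y) u \<le> norm u * (area x u + area y u)"
    unfolding distrib_left norm_mult_area
    by (rule order_trans[OF eq_refl norm_triangle_ineq])
      (simp add: cinner_add_left scaleC_add_left scaleC_add_right algebra_simps)
  then show ?thesis using False by simp
qed

lemma area_sum_left: "area (sum f A) u \<le> (\<Sum>i\<in>A. area (f i) u)"
proof (induction A rule: infinite_finite_induct)
  case (insert i A)
  then show ?case using area_add_left[of "f i" "sum f A" u] by simp
qed auto

text \<open>A shear along \<open>x\<close> preserves the area, because the component orthogonal to
  \<open>x\<close> does not see multiples of \<open>x\<close>. This trades
  \<open>X j - \<beta> j *\<^sub>C T (X j)\<close> for \<open>T (X j)\<close> below.\<close>

lemma area_diff_scaleC_right: "area x (x - b *\<^sub>C v) = cmod b * area x v"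
proof (cases "x = 0")
  case False
  let ?N = "complex_of_real ((norm x)\<^sup>2)"
  have "norm x * area x (x - b *\<^sub>C v) = norm (?N *\<^sub>C (x - b *\<^sub>C v) - cinner (x - b *\<^sub>C v) x *\<^sub>C x)"
    by (metis area_commute norm_mult_area)
  also have "?N *\<^sub>C (x - b *\<^sub>C v) - cinner (x - b *\<^sub>C v) x *\<^sub>C x
      = (- b) *\<^sub>C (?N *\<^sub>C v - cinner v x *\<^sub>C x)"
    by (simp add: complex_vector.scale_right_diff_distrib complex_vector.scale_left_diff_distrib
        cinner_diff_left cinner_scaleC_left cinner_self scaleC_scaleC mult.commute)
  also have "norm \<dots> = cmod b * (norm x * area x v)"
    unfolding norm_scaleC by (metis area_commute norm_mult_area norm_minus_cancel)
  finally show ?thesis using False by simp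
qed simp

lemma area_scaleC:
  "area (a *\<^sub>C x) (b *\<^sub>C u) = cmod a * cmod b * area x u"
proof -
  have "(norm (a *\<^sub>C x))\<^sup>2 * (norm (b *\<^sub>C u))\<^sup>2 - (cmod (cinner (a *\<^sub>C x) (b *\<^sub>C u)))\<^sup>2
    = (cmod a * cmod b)\<^sup>2 * ((norm x)\<^sup>2 * (norm u)\<^sup>2 - (cmod (cinner x u))\<^sup>2)"
    by (simp add: cinner_scaleC_left cinner_scaleC_right norm_mult power_mult_distrib algebra_simps)
  then show ?thesis
    by (simp add: area_def real_sqrt_mult)
qed

lemma norm_component:
  assumes "norm x = 1"
  shows "norm (u - cinner u x *\<^sub>C x) = area x u"
  using norm_mult_area[of x u] assms scaleC_of_real[of 1 u] by (simp add: area_commute)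

lemma cinner_component:
  assumes "norm x = 1"
  shows "cinner (u - cinner u x *\<^sub>C x) x = 0"
  using assms by (simp add: cinner_diff_left cinner_scaleC_left cinner_self)

text \<open>A vector \<open>z\<close> orthogonal to \<open>x\<close> only sees the component of
  \<open>u\<close> orthogonal to \<open>x\<close>, whose norm is the area; Cauchy-Schwarz does the
  rest.\<close>

lemma cinner_orthogonal_le_area:
  assumes "norm x = 1" "cinner x z = 0"
  shows "cmod (cinner u z) \<le> area x u * norm z"
proof -
  have "cinner u z = cinner (u - cinner u x *\<^sub>C x) z"
    using assms by (simp add: cinner_diff_left cinner_scaleC_left)
  then show ?thesis
    using complex_Cauchy_Schwarz[of "u - cinner u x *\<^sub>C x" z] norm_component[OF assms(1)] by simp
qed

text \<open>Equality in the preceding bound, attained at the normalised orthogonal component of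
  \<open>u\<close>. If that component vanishes, any unit vector orthogonal to \<open>x\<close>
  serves, and \<open>e\<close> supplies one.\<close>

lemma area_attained:
  fixes x u e :: "'a::complex_inner"
  assumes "norm x = 1" "norm e = 1" "cinner e x = 0"
  obtains z where "norm z = 1" "cinner x z = 0" "cinner u z = complex_of_real (area x u)"
proof (cases "area x u = 0")
  case True
  have "cinner x e = 0" using assms(3) cinner_commute[of x e] by simp
  moreover from this have "cinner u e = 0"
    using cinner_orthogonal_le_area[OF assms(1), of e u] True by simp
  ultimately show ?thesis using that[of e] assms True by simp
next
  case False
  define w where "w = u - cinner u x *\<^sub>C x"
  define z where "z = complex_of_real (1 / area x u) *\<^sub>C w"
  have nw: "norm w = area x u" and wx: "cinner w x = 0"
    using norm_component cinner_component assms(1) unfolding w_def by blast+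
  have xw: "cinner x w = 0" using wx cinner_commute[of x w] by simp
  have "cinner u w = cinner w w"
    using xw unfolding w_def[symmetric]
    by (metis w_def cinner_diff_left cinner_scaleC_left mult_zero_right diff_zero)
  then have "cinner u z = complex_of_real (area x u)"
    using False nw by (simp add: z_def cinner_scaleC_right cinner_self power2_eq_square)
  moreover have "cinner x z = 0" using xw by (simp add: z_def cinner_scaleC_right)
  moreover have "norm z = 1"
    using False nw area_nonneg[of x u] by (simp add: z_def norm_divide)
  ultimately show ?thesis using that by blast
qed

section \<open>The power inequality\<close>

text \<open>The sum is geometric with ratio \<open>\<rho>\<close>, an m-th root of unity that
  differs from 1 because \<open>0 < k < m\<close>.\<close>

lemma sum_powers_root_of_unity:
  assumes "0 < k" "k < m"
  shows "(\<Sum>j<m. cis (2 * pi * real j / real m) ^ k) = 0"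
proof -
  define \<rho> where "\<rho> = cis (2 * pi * real k / real m)"
  have m: "m > 0" using assms by simp
  have "\<rho> \<noteq> 1"
  proof
    assume "\<rho> = 1"
    moreover have "inj_on (\<lambda>k. cis (2 * pi * real k / real m)) {..<m}"
      using Complex.bij_betw_roots_unity[OF m] by (rule bij_betw_imp_inj_on)
    ultimately have "k = 0"
      using assms inj_onD[of "\<lambda>k. cis (2 * pi * real k / real m)" "{..<m}" k 0] by (simp add: \<rho>_def)
    then show False using assms by simp
  qed
  moreover have "\<rho> ^ m = 1"
    using m by (simp add: \<rho>_def Complex.DeMoivre)
  moreover have "cis (2 * pi * real j / real m) ^ k = \<rho> ^ j" for j
    by (simp add: \<rho>_def Complex.DeMoivre algebra_simps)
  ultimately show ?thesis by (simp add: geometric_sum)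
qed

lemma power_inequality_area:
  fixes T :: "'a::complex_inner \<Rightarrow> 'a" and q c :: real
  assumes T: "bounded_clinear T" and q: "0 < q" "q \<le> 1" and c: "c > 0" and m: "m > 0"
    and bound: "\<And>x. q * cmod (cinner (T x) x) + sqrt (1 - q\<^sup>2) * area x (T x) \<le> q * c * (norm x)\<^sup>2"
    and x: "norm x = 1" and y: "norm y = 1" and xy: "cinner x y = complex_of_real q"
  shows "cmod (cinner ((T ^^ m) x) y) \<le> q * c ^ m"
proof -
  define s where "s = sqrt (1 - q\<^sup>2)"
  have s0: "s \<ge> 0" using q by (auto simp: s_def abs_square_le_1)
  interpret T: bounded_linear T using T by (simp add: bounded_clinear_def)
  have Tc: "T (a *\<^sub>C v) = a *\<^sub>C T v" for a v using T by (simp add: bounded_clinear_def)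
  define d where "d = cinner ((T ^^ m) x) y"
  obtain \<zeta>' where \<zeta>': "cmod \<zeta>' = 1" "\<zeta>' * d = complex_of_real (cmod d)"
    by (rule obtain_phase)
  \<comment> \<open>An m-th root of the phase, to be absorbed into \<open>T\<close>; this makes
    \<open>cinner ((T ^^ m) x) y\<close> real and nonnegative.\<close>
  obtain \<zeta> where \<zeta>: "\<zeta> ^ m = \<zeta>'" "cmod \<zeta> = 1"
  proof
    show "cis (Arg \<zeta>' / m) ^ m = \<zeta>'"
      using \<zeta>'(1) m cis_Arg[of \<zeta>'] by (cases "\<zeta>' = 0") (simp_all add: Complex.DeMoivre sgn_div_norm)
  qed simp
  \<comment> \<open>The numbers \<open>\<beta> j\<close> are the m-th roots of
    \<open>\<zeta>' / c ^ m\<close>: the overview's roots of unity, adapted to the operator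
    \<open>(\<zeta> / c) T\<close>.\<close>
  define \<beta> where "\<beta> j = cis (2 * pi * real j / real m) * \<zeta> / c" for j
  have n\<beta>: "cmod (\<beta> j) = 1 / c" for j using c by (simp add: \<beta>_def \<zeta> norm_mult norm_divide)
  have \<beta>m: "\<beta> j ^ m = \<zeta>' / c ^ m" for j
    using m by (simp add: \<beta>_def power_mult_distrib power_divide \<zeta> Complex.DeMoivre)
  define X where "X j = (1 / of_nat m :: complex) *\<^sub>C (\<Sum>k<m. (\<beta> j ^ k) *\<^sub>C (T ^^ k) x)" for j
  define u where "u = (1 / of_nat m :: complex) *\<^sub>C (x - (\<zeta>' / c ^ m) *\<^sub>C (T ^^ m) x)"
  \<comment> \<open>The sum telescopes to its terms at 0 and \<open>m\<close>, and the latter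
    involves \<open>j\<close> only through \<open>\<beta> j ^ m\<close>, which is constant.\<close>
  have Xu: "X j - \<beta> j *\<^sub>C T (X j) = u" for j
  proof -
    have "\<beta> j *\<^sub>C T (X j) = (1 / of_nat m :: complex) *\<^sub>C (\<Sum>k<m. (\<beta> j ^ Suc k) *\<^sub>C (T ^^ Suc k) x)"
      by (simp add: X_def Tc T.sum complex_vector.scale_sum_right scaleC_scaleC mult.left_commute mult.commute)
    then have "X j - \<beta> j *\<^sub>C T (X j) = (1 / of_nat m :: complex) *\<^sub>C
        (\<Sum>k<m. (\<beta> j ^ k) *\<^sub>C (T ^^ k) x - (\<beta> j ^ Suc k) *\<^sub>C (T ^^ Suc k) x)"
      by (simp only: X_def complex_vector.scale_right_diff_distrib sum_subtractf)
    also have "\<dots> = u"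
      using sum_lessThan_telescope'[of "\<lambda>k. (\<beta> j ^ k) *\<^sub>C (T ^^ k) x" m]
      by (simp only: u_def \<beta>m) simp
    finally show ?thesis .
  qed
  have Xsum: "(\<Sum>j<m. X j) = x"
  proof -
    have "(\<Sum>j<m. X j) = (1 / of_nat m :: complex) *\<^sub>C (\<Sum>k<m. (\<Sum>j<m. \<beta> j ^ k) *\<^sub>C (T ^^ k) x)"
      unfolding X_def complex_vector.scale_sum_right[symmetric] complex_vector.scale_sum_left
      by (subst sum.swap) simp
    \<comment> \<open>Summing over \<open>j\<close> annihilates every power of \<open>T\<close>
      except the zeroth.\<close>
    also have "(\<Sum>k<m. (\<Sum>j<m. \<beta> j ^ k) *\<^sub>C (T ^^ k) x) = (\<Sum>k<m. if k = 0 then (of_nat m :: complex) *\<^sub>C x else 0)"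
    proof (rule sum.cong[OF refl])
      fix k assume k: "k \<in> {..<m}"
      have "(\<Sum>j<m. \<beta> j ^ k) = (\<Sum>j<m. cis (2 * pi * real j / real m) ^ k) * (\<zeta> / c) ^ k"
        by (simp add: \<beta>_def power_mult_distrib power_divide sum_distrib_right sum_divide_distrib)
      also have "\<dots> = (if k = 0 then of_nat m else 0)"
        using k sum_powers_root_of_unity[of k m] by simp
      finally show "(\<Sum>j<m. \<beta> j ^ k) *\<^sub>C (T ^^ k) x = (if k = 0 then (of_nat m :: complex) *\<^sub>C x else 0)"
        by simp
    qed
    also have "(1 / of_nat m :: complex) *\<^sub>C \<dots> = x"
      using m by (simp add: scaleC_scaleC)
    finally show ?thesis .
  qed
  \<comment> \<open>This is \<open>bound\<close> at \<open>X j\<close>, divided by \<open>c\<close>: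
    the shear turns the area with \<open>u\<close> into \<open>1 / c\<close> times the area with
    \<open>T (X j)\<close>, and expanding \<open>cinner u (X j)\<close> leaves the square of the
    norm minus a term of modulus at most \<open>cmod (cinner (T (X j)) (X j)) / c\<close>.\<close>
  have summand: "s * area (X j) u \<le> q * Re (cinner u (X j))" for j
  proof -
    have "Re (\<beta> j * cinner (T (X j)) (X j)) \<le> cmod (cinner (T (X j)) (X j)) / c"
      using complex_Re_le_cmod[of "\<beta> j * cinner (T (X j)) (X j)"] by (simp add: norm_mult n\<beta>)
    moreover have "Re (cinner u (X j)) = (norm (X j))\<^sup>2 - Re (\<beta> j * cinner (T (X j)) (X j))"
      unfolding Xu[of j, symmetric] by (simp add: cinner_diff_left cinner_scaleC_left cinner_self)
    ultimately have "q * Re (cinner u (X j)) \<ge> q * ((norm (X j))\<^sup>2 - cmod (cinner (T (X j)) (X j)) / c)"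
      using q by (intro mult_left_mono) auto
    moreover have "s * area (X j) u = s * area (X j) (T (X j)) / c"
      unfolding Xu[of j, symmetric] area_diff_scaleC_right n\<beta> by simp
    moreover have "s * area (X j) (T (X j)) / c \<le> q * ((norm (X j))\<^sup>2 - cmod (cinner (T (X j)) (X j)) / c)"
      using bound[of "X j"] c by (simp add: s_def field_simps)
    ultimately show ?thesis by linarith
  qed
  \<comment> \<open>Split \<open>y\<close> into \<open>q\<close> times \<open>x\<close> and a part
    \<open>z\<close> of norm \<open>s\<close> orthogonal to \<open>x\<close>.\<close>
  define z where "z = y - complex_of_real q *\<^sub>C x"
  have yx: "cinner y x = complex_of_real q" using xy cinner_commute[of y x] by simp
  have "cinner z x = 0" using cinner_component[OF x, of y] by (simp add: z_def yx)
  then have xz: "cinner x z = 0" using cinner_commute[of x z] by simp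
  have nz: "norm z = s"
    using norm_component[OF x, of y] by (simp add: z_def yx area_def x y xy s_def)
  have "cinner u y = complex_of_real q * cinner u x + cinner u z"
    using cinner_add_right[of u "complex_of_real q *\<^sub>C x" z] by (simp add: z_def cinner_scaleC_right)
  then have "Re (cinner u y) = q * Re (cinner u x) + Re (cinner u z)" by simp
  moreover have "Re (cinner u z) \<ge> - (s * area x u)"
    using cinner_orthogonal_le_area[OF x xz, of u] abs_Re_le_cmod[of "cinner u z"]
    by (simp add: nz mult.commute)
  moreover have "s * area x u \<le> q * Re (cinner u x)"
  proof -
    have "s * area x u \<le> s * (\<Sum>j<m. area (X j) u)"
      using area_sum_left[of X "{..<m}" u] s0 by (simp add: Xsum mult_left_mono)
    also have "\<dots> \<le> (\<Sum>j<m. q * Re (cinner u (X j)))"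
      unfolding sum_distrib_left by (intro sum_mono summand)
    also have "\<dots> = q * Re (cinner u x)"
      by (subst Xsum[symmetric]) (simp add: cinner_sum_right sum_distrib_left)
    finally show ?thesis .
  qed
  ultimately have "Re (cinner u y) \<ge> 0" by linarith
  \<comment> \<open>Here the choice of phase pays off: the nonnegative real part is
    \<open>q - cmod d / c ^ m\<close> up to the factor \<open>1 / m\<close>.\<close>
  moreover have "cinner u y = complex_of_real ((q - cmod d / c ^ m) / m)"
    using \<zeta>' by (simp add: u_def cinner_scaleC_left cinner_diff_left xy d_def[symmetric])
  ultimately have "cmod d / c ^ m \<le> q" using m by (simp add: zero_le_divide_iff)
  then show ?thesis using c by (simp add: d_def field_simps)
qed

lemma q_numerical_radius_bound:
  assumes "bounded_clinear T" "norm x = 1" "norm y = 1" "cinner x y = q"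
  shows "cmod (cinner (T x) y) \<le> q_numerical_radius q T"
proof -
  let ?S = "{cmod (cinner (T x) y) | x y. norm x = 1 \<and> norm y = 1 \<and> cinner x y = q}"
  have "v \<le> onorm T" if "v \<in> ?S" for v
  proof -
    from that obtain x y where v: "v = cmod (cinner (T x) y)" "norm x = 1" "norm y = 1" by blast
    have "v \<le> norm (T x) * norm y" using v complex_Cauchy_Schwarz by blast
    also have "norm (T x) \<le> onorm T"
      using onorm[of T x] assms(1) v by (simp add: bounded_clinear_def)
    finally show ?thesis using v by simp
  qed
  then have "bdd_above ?S" by (rule bdd_aboveI)
  moreover have in_S: "cmod (cinner (T x) y) \<in> ?S" using assms by blast
  ultimately have "cmod (cinner (T x) y) \<le> Sup ?S" by (intro cSup_upper)
  moreover have "q_numerical_radius q T = Sup ?S"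
    using in_S by (auto simp only: q_numerical_radius_def Let_def if_False empty_iff split: if_split)
  ultimately show ?thesis by simp
qed

text \<open>Nonnegativity of \<open>b\<close> covers the empty set of pairs, where the radius is 0
  by convention.\<close>

lemma q_numerical_radius_least:
  assumes "\<And>x y. norm x = 1 \<Longrightarrow> norm y = 1 \<Longrightarrow> cinner x y = q \<Longrightarrow> cmod (cinner (T x) y) \<le> b"
    and "b \<ge> 0"
  shows "q_numerical_radius q T \<le> b"
  proof -
  let ?S = "{cmod (cinner (T x) y) | x y. norm x = 1 \<and> norm y = 1 \<and> cinner x y = q}"
  have "Sup ?S \<le> b" if "?S \<noteq> {}"
    using that by (rule cSup_least) (use assms(1) in blast)
  then show ?thesis
    using assms(2) by (simp only: q_numerical_radius_def Let_def split: if_split) simp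
qed

lemma q_numerical_radius_nonneg:
  assumes "bounded_clinear T"
  shows "q_numerical_radius q T \<ge> 0"
proof (cases "\<exists>x y :: 'a. norm x = 1 \<and> norm y = 1 \<and> cinner x y = q")
  case True
  then show ?thesis
    using q_numerical_radius_bound[OF assms] norm_ge_zero order_trans by blast
next
  case False
  then show ?thesis by (simp add: q_numerical_radius_def)
qed

lemma power_inequality:
  fixes T :: "'a::complex_inner \<Rightarrow> 'a" and q :: real
  assumes T: "bounded_clinear T" and q: "0 < q" "q \<le> 1" and m: "m > 0"
    and dim: "\<And>x :: 'a. norm x = 1 \<Longrightarrow> \<exists>e. norm e = 1 \<and> cinner e x = 0"
    and xy: "norm x = 1" "norm y = 1" "cinner x y = complex_of_real q"
  shows "cmod (cinner ((T ^^ m) x) y) \<le> q * (q_numerical_radius q T / q) ^ m"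
proof -
  let ?W = "q_numerical_radius (complex_of_real q) T"
  define s where "s = sqrt (1 - q\<^sup>2)"
  have s2: "s\<^sup>2 = 1 - q\<^sup>2" using q by (auto simp: s_def abs_square_le_1)
  have W0: "?W \<ge> 0" using q_numerical_radius_nonneg[OF T] .
  have unit: "q * cmod (cinner (T x) x) + s * area x (T x) \<le> ?W" if x: "norm x = 1" for x
  proof -
    obtain e where "norm e = 1" "cinner e x = 0" using dim[OF x] by blast
    then obtain z where z: "norm z = 1" "cinner x z = 0" "cinner (T x) z = complex_of_real (area x (T x))"
      using area_attained[OF x] by metis
    obtain \<zeta> where \<zeta>: "cmod \<zeta> = 1" "\<zeta> * cinner (T x) x = complex_of_real (cmod (cinner (T x) x))"
      by (rule obtain_phase)
    \<comment> \<open>The maximising \<open>y\<close>: the phase \<open>\<zeta>\<close> aligns the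
      contributions of \<open>x\<close> and \<open>z\<close> to \<open>cinner (T x) y\<close>, so
      that their moduli add.\<close>
    let ?y = "complex_of_real q *\<^sub>C x + (s * \<zeta>) *\<^sub>C z"
    have zx: "cinner z x = 0" using z(2) cinner_commute[of z x] by simp
    have \<zeta>\<zeta>: "\<zeta> * cnj \<zeta> = 1" using \<zeta>(1) complex_norm_square[of \<zeta>] by simp
    have "cinner ?y ?y = complex_of_real (q\<^sup>2) + complex_of_real (s\<^sup>2) * (\<zeta> * cnj \<zeta>)"
      by (simp add: cinner_add_left cinner_add_right cinner_scaleC_left cinner_scaleC_right
          cinner_self[of x] cinner_self[of z] x z zx power2_eq_square)
    then have "complex_of_real ((norm ?y)\<^sup>2) = complex_of_real (q\<^sup>2 + s\<^sup>2)"
      by (simp only: cinner_self \<zeta>\<zeta> mult_1_right of_real_add)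
    then have "(norm ?y)\<^sup>2 = 1" unfolding of_real_eq_iff using s2 by simp
    then have "norm ?y = 1" by (metis norm_ge_zero abs_of_nonneg real_sqrt_abs real_sqrt_one)
    moreover have "cinner x ?y = complex_of_real q"
      using x z by (simp add: cinner_add_right cinner_scaleC_right cinner_self)
    ultimately have "cmod (cinner (T x) ?y) \<le> ?W" using q_numerical_radius_bound[OF T x] by blast
    moreover have "\<zeta> * cinner (T x) ?y = complex_of_real (q * cmod (cinner (T x) x) + s * area x (T x))"
    proof -
      have "\<zeta> * cinner (T x) ?y = q * (\<zeta> * cinner (T x) x) + s * (\<zeta> * cnj \<zeta>) * cinner (T x) z"
        by (simp add: cinner_add_right cinner_scaleC_right algebra_simps)
      then show ?thesis unfolding \<zeta>\<zeta> \<zeta>(2) z(3) by simp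
    qed
    then have "cmod (cinner (T x) ?y) = \<bar>q * cmod (cinner (T x) x) + s * area x (T x)\<bar>"
      using \<zeta>(1) by (metis norm_mult mult_1 norm_of_real)
    ultimately show ?thesis by linarith
  qed
  \<comment> \<open>Both sides are homogeneous of degree two, so normalising \<open>v\<close>
    reduces to \<open>unit\<close>.\<close>
  have all: "q * cmod (cinner (T v) v) + s * area v (T v) \<le> ?W * (norm v)\<^sup>2" for v
  proof (cases "v = 0")
    case False
    define e where "e = complex_of_real (1 / norm v) *\<^sub>C v"
    have e: "norm e = 1" using False by (simp add: e_def norm_divide)
    have v: "v = complex_of_real (norm v) *\<^sub>C e"
      using False scaleC_of_real[of 1 v] by (simp add: e_def scaleC_scaleC)
    have Tv: "T v = complex_of_real (norm v) *\<^sub>C T e"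
      using T v unfolding bounded_clinear_def by metis
    have "cinner (T v) v = complex_of_real ((norm v)\<^sup>2) * cinner (T e) e"
      by (subst Tv, subst (2) v) (simp add: cinner_scaleC_left cinner_scaleC_right power2_eq_square)
    then have 1: "cmod (cinner (T v) v) = (norm v)\<^sup>2 * cmod (cinner (T e) e)"
      by (simp add: norm_mult del: of_real_power)
    have 2: "area v (T v) = (norm v)\<^sup>2 * area e (T e)"
      by (subst Tv, subst (1) v) (simp add: area_scaleC power2_eq_square)
    show ?thesis unfolding 1 2
      using mult_left_mono[OF unit[OF e], of "(norm v)\<^sup>2"] by (simp add: algebra_simps)
  qed simp
  \<comment> \<open>The area version divides by \<open>c\<close>, but the radius may be 0; hence a
    positive \<open>\<epsilon>\<close> is added and then sent to 0 from the right.\<close>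
  have eps: "cmod (cinner ((T ^^ m) x) y) \<le> q * (?W / q + \<epsilon>) ^ m" if "\<epsilon> > 0" for \<epsilon>
  proof (rule power_inequality_area[OF T q _ m _ xy])
    show "?W / q + \<epsilon> > 0" using that W0 q by (simp add: add_nonneg_pos)
    fix v :: 'a
    have "?W * (norm v)\<^sup>2 \<le> q * (?W / q + \<epsilon>) * (norm v)\<^sup>2"
      using q that by (intro mult_right_mono) (auto simp: field_simps)
    then show "q * cmod (cinner (T v) v) + sqrt (1 - q\<^sup>2) * area v (T v) \<le> q * (?W / q + \<epsilon>) * (norm v)\<^sup>2"
      using all[of v] unfolding s_def by linarith
  qed
  have "((\<lambda>\<epsilon>. q * (?W / q + \<epsilon>) ^ m) \<longlongrightarrow> q * (?W / q + 0) ^ m) (at_right 0)"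
    by (intro tendsto_intros)
  then show ?thesis
    using tendsto_lowerbound[of "\<lambda>\<epsilon>. q * (?W / q + \<epsilon>) ^ m" _ "at_right 0"] eps
    by (auto simp: eventually_at_right_less eventually_at_filter)
qed

section \<open>Off-diagonal operator matrices\<close>

lemma bounded_clinear_compose:
  assumes "bounded_clinear A" "bounded_clinear B"
  shows "bounded_clinear (A \<circ> B)"
  using assms bounded_linear_compose[of A B] by (simp add: bounded_clinear_def comp_def)

lemma bounded_clinear_funpow:
  fixes A :: "'a::complex_inner \<Rightarrow> 'a"
  assumes "bounded_clinear A"
  shows "bounded_clinear (A ^^ n)"
proof (induction n)
  case 0
  have "A ^^ 0 = (\<lambda>x. x)" by (simp add: fun_eq_iff)
  then show ?case unfolding bounded_clinear_def by (simp only: bounded_linear_ident) simp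
next
  case (Suc n)
  then show ?case
    using bounded_clinear_compose[OF assms] by (simp only: funpow.simps)
qed

lemma bounded_clinear_off_diagonal:
  assumes "bounded_clinear A" "bounded_clinear B"
  shows "bounded_clinear (op_matrix (\<lambda>_. 0) A B (\<lambda>_. 0))"
proof -
  have "bounded_linear A" "bounded_linear B" using assms by (auto simp: bounded_clinear_def)
  then have "bounded_linear (\<lambda>p. (A (snd p), B (fst p)))"
    by (intro bounded_linear_Pair bounded_linear_compose[OF _ bounded_linear_fst]
        bounded_linear_compose[OF _ bounded_linear_snd])
  then show ?thesis
    using assms by (simp add: bounded_clinear_def op_matrix_def case_prod_unfold scaleC_prod_def)
qed

lemma off_diagonal_power:
  "(op_matrix (\<lambda>_. 0) A B (\<lambda>_. 0) ^^ (2 * n)) (x, y) = (((A \<circ> B) ^^ n) x, ((B \<circ> A) ^^ n) y)"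
  by (induction n) (simp_all add: op_matrix_def)

text \<open>The vectors \<open>(e, 0)\<close> and \<open>(0, e)\<close> are independent, so some
  nonzero combination of them is orthogonal to \<open>x\<close>. This provides the orthogonal
  vectors that \<open>power_inequality\<close> asks for.\<close>

lemma ex_orthogonal_unit_prod:
  fixes e :: "'a::complex_inner" and x :: "'a \<times> 'a"
  assumes "norm e = 1"
  shows "\<exists>z. norm z = 1 \<and> cinner z x = 0"
proof (cases "cinner (e, 0) x = 0")
  case True
  then show ?thesis using assms by (intro exI[of _ "(e, 0)"]) (simp add: norm_Pair)
next
  case False
  define z where "z = cinner (0, e) x *\<^sub>C (e, 0) - cinner (e, 0) x *\<^sub>C (0, e)"
  have "snd z \<noteq> 0"
    using False assms by (auto simp: z_def scaleC_prod_def)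
  then have "z \<noteq> 0" by auto
  moreover have "cinner z x = 0"
    by (simp add: z_def cinner_diff_left cinner_scaleC_left)
  ultimately show ?thesis
    by (intro exI[of _ "complex_of_real (1 / norm z) *\<^sub>C z"])
      (simp add: cinner_scaleC_left norm_divide)
qed

theorem theorem2p14:
  fixes T2 T3 :: "'h::complex_hilbert \<Rightarrow> 'h"
    and q :: real
    and n :: nat
  assumes "bounded_clinear T2" and "bounded_clinear T3"
    and "0 < q" and "q \<le> 1"
    and "q < 1 \<Longrightarrow> \<exists>B :: 'h set. complex_vector.independent B \<and> card B = 2"
    and "n \<ge> 1"
  shows "q_numerical_radius (complex_of_real q) (op_matrix (\<lambda>_. 0) T2 T3 (\<lambda>_. 0)) \<ge>
    q ^ (2 * n - 1) *
      (max (q_numerical_radius (complex_of_real q) ((T2 \<circ> T3) ^^ n))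
           (q_numerical_radius (complex_of_real q) ((T3 \<circ> T2) ^^ n))) powr (1 / (2 * real n))"
proof -
  let ?M = "op_matrix (\<lambda>_. 0) T2 T3 (\<lambda>_. 0)"
  let ?W = "q_numerical_radius (complex_of_real q) ?M"
  let ?b = "max (q_numerical_radius (complex_of_real q) ((T2 \<circ> T3) ^^ n))
           (q_numerical_radius (complex_of_real q) ((T3 \<circ> T2) ^^ n))"
  have M: "bounded_clinear ?M" using assms by (intro bounded_clinear_off_diagonal)
  have W0: "?W \<ge> 0" using M by (rule q_numerical_radius_nonneg)
  let ?c = "q * (?W / q) ^ (2 * n)"
  have c0: "?c \<ge> 0" using assms W0 by simp
  have power: "cmod (cinner ((?M ^^ (2 * n)) x) y) \<le> ?c"
    if "norm (e::'h) = 1" "norm x = 1" "norm y = 1" "cinner x y = complex_of_real q" for e x y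
    using power_inequality[OF M assms(3,4) _ ex_orthogonal_unit_prod[OF that(1)] that(2-4), of "2 * n"] assms(6)
    by simp
  \<comment> \<open>Each coordinate embedding preserves norms and inner products, and the even power
    of \<open>?M\<close> acts diagonally. The unit vector \<open>x\<close> itself plays the part of
    \<open>e\<close>.\<close>
  have "cmod (cinner (((T2 \<circ> T3) ^^ n) x) y) \<le> ?c" "cmod (cinner (((T3 \<circ> T2) ^^ n) x) y) \<le> ?c"
    if "norm x = 1" "norm y = 1" "cinner x y = complex_of_real q" for x y
    using power[OF that(1), of "(x, 0)" "(y, 0)"] power[OF that(1), of "(0, x)" "(0, y)"] that
    by (auto simp: off_diagonal_power cinner_prod_def norm_Pair)
  then have b: "?b \<le> ?c" using c0 by (auto intro!: q_numerical_radius_least)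
  have b0: "?b \<ge> 0"
    using q_numerical_radius_nonneg[OF bounded_clinear_funpow[OF bounded_clinear_compose[OF assms(1,2)]]]
    by (simp add: le_max_iff_disj)
  \<comment> \<open>Dropping the factor \<open>q\<close> leaves a pure power, whose root of order
    \<open>2 * n\<close> is \<open>?W / q\<close>.\<close>
  have "?c \<le> (?W / q) ^ (2 * n)"
    using assms W0 by (intro mult_left_le_one_le) auto
  also have "\<dots> = (?W / q) powr (2 * real n)"
    using powr_realpow'[of "?W / q" "2 * n"] assms W0 by simp
  finally have "?b powr (1 / (2 * real n)) \<le> ((?W / q) powr (2 * real n)) powr (1 / (2 * real n))"
    using b b0 by (intro powr_mono2) auto
  also have "\<dots> = ?W / q"
    using assms W0 by (simp add: powr_powr)
  finally have b_root: "?b powr (1 / (2 * real n)) \<le> ?W / q" .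
  \<comment> \<open>Since \<open>2 * n - 1\<close> is at least 1, the factor is at most
    \<open>q\<close>, which cancels the denominator of \<open>?W / q\<close>.\<close>
  have "q ^ (2 * n - 1) \<le> q"
    using assms power_decreasing[of 1 "2 * n - 1" q] by simp
  then have "q ^ (2 * n - 1) * ?b powr (1 / (2 * real n)) \<le> q * (?W / q)"
    using b_root assms W0 by (intro mult_mono) auto
  then show ?thesis using assms by simp
qed

end
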